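(* Let $G_1$ and $G_2$ be finite groups, let $\chi_1$ be a virtual character of $G_1$ and let $\chi_2$ be a virtual character of $G_2$. Let $\chi_1\chi_2$ be the virtual character of $G_1\times G_2$ defined by $\chi_1\chi_2((g_1,g_2)):=\chi_1(g_1)\chi_2(g_2)$. Then for all $g_1\in G_1$ and $g_2\in G_2$, $$\lambda_t(\chi_1\chi_2)((g_1,g_2))=\lambda_t(\chi_1)(g_1)\cdot_{\Lambda}\lambda_t(\chi_2)(g_2)$$ in $\Lambda(\mathbb{C})$.
   Context: For a finite group $G$, $CF(G)$ is the commutative $\mathbb{C}$-algebra of class functions $f:G\to\mathbb{C}$ with pointwise operations. A virtual character of $G$ is a $\mathbb{Z}$-linear combination of irreducible complex characters of $G$. $CF(G)$ carries the $\lambda$-ring structure whose $n$-th Adams operation is $\psi^n(f)(g)=f(g^n)$; explicitly, $\lambda_t(f)=\sum_{i\ge0}\lambda^i(f)t^i=\exp\big(-\sum_{i\ge1}\frac{\psi^i(f)}{i}(-t)^i\big)$. For $g\in G$, $\lambda_t(f)(g)=\sum_{i\ge0}\lambda^i(f)(g)t^i\in\Lambda(\mathbb{C})$. $\Lambda(\mathbb{C})=1+t\mathbb{C}[[t]]$ is the universal $\lambda$-ring: its addition is the multiplication of power series, and its multiplication $\cdot_\Lambda$ is the standard one, given by universal polynomials in the coefficients determined by $\prod_i(1+a_it)\cdot_\Lambda\prod_j(1+b_jt)=\prod_{i,j}(1+a_ib_jt)$. Over $\mathbb{C}$, equivalently: the map $z:\Lambda(\mathbb{C})\to\mathbb{C}^{\mathbb{N}}$,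 $z(f)=(a_1,a_2,\ldots)$ with $\sum_{i\ge1}a_i(-t)^i=-t\frac{d}{dt}\log f(t)$, is an injective ring homomorphism, where $\mathbb{C}^{\mathbb{N}}$ has componentwise operations. *)

theory Defs
  imports
    "HOL-Algebra.Group"
    "HOL-Computational_Algebra.Formal_Power_Series"
    "HOL-Library.Function_Algebras"
    "HOL-Library.Poly_Mapping"
    "Jordan_Normal_Form.VS_Connect"
begin

definition GL :: "nat \<Rightarrow> complex mat monoid" where
  "GL n = units_of (ring_mat TYPE(complex) n ())"

definition irreducible_rep ::
  "('a, 'm) monoid_scheme \<Rightarrow> nat \<Rightarrow> ('a \<Rightarrow> complex mat) \<Rightarrow> bool" where
  "irreducible_rep G n \<rho> \<longleftrightarrow>
     n > 0 \<and> \<rho> \<in> hom G (GL n) \<and>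
     (\<forall>W. subspace class_ring W (module_vec TYPE(complex) n) \<and>
          (\<forall>g \<in> carrier G. \<forall>w \<in> W. \<rho> g *\<^sub>v w \<in> W) \<longrightarrow>
          W = {0\<^sub>v n} \<or> W = carrier_vec n)"

definition mat_trace :: "complex mat \<Rightarrow> complex" where
  "mat_trace A = (\<Sum>i<dim_row A. A $$ (i, i))"

definition irr_characters :: "('a, 'm) monoid_scheme \<Rightarrow> ('a \<Rightarrow> complex) set" where
  "irr_characters G = {\<lambda>g. mat_trace (\<rho> g) | \<rho>. \<exists>n. irreducible_rep G n \<rho>}"

text \<open>Functions on a group are total functions on the underlying type; only their values on
  the carrier are meaningful, so characters are compared on the carrier only.\<close>

definition virtual_character :: "('a, 'm) monoid_scheme \<Rightarrow> ('a \<Rightarrow> complex) \<Rightarrow> bool" where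
  "virtual_character G \<chi> \<longleftrightarrow>
     (\<exists>S c. finite S \<and> S \<subseteq> irr_characters G \<and>
        (\<forall>g \<in> carrier G. \<chi> g = (\<Sum>\<phi>\<in>S. of_int (c \<phi> :: int) * \<phi> g)))"

definition ext_prod :: "('a \<Rightarrow> complex) \<Rightarrow> ('b \<Rightarrow> complex) \<Rightarrow> 'a \<times> 'b \<Rightarrow> complex" where
  "ext_prod \<chi>\<^sub>1 \<chi>\<^sub>2 = (\<lambda>(g\<^sub>1, g\<^sub>2). \<chi>\<^sub>1 g\<^sub>1 * \<chi>\<^sub>2 g\<^sub>2)"

definition adams :: "('a, 'm) monoid_scheme \<Rightarrow> nat \<Rightarrow> ('a \<Rightarrow> complex) \<Rightarrow> 'a \<Rightarrow> complex" where
  "adams G n f = (\<lambda>g. f (g [^]\<^bsub>G\<^esub> n))"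

text \<open>The coefficient ring of the following power series is the ring of functions with its
  pointwise operations, of which class functions form a subring (up to the values outside the
  carrier). The library constant \<open>fps_exp\<close> is not available over this ring, as it is not a
  field.\<close>

definition exp_series :: "('a \<Rightarrow> complex) fps" where
  "exp_series = Abs_fps (\<lambda>k. \<lambda>_. 1 / fact k)"

definition lambda_t :: "('a, 'm) monoid_scheme \<Rightarrow> ('a \<Rightarrow> complex) \<Rightarrow> ('a \<Rightarrow> complex) fps" where
  "lambda_t G f =
     exp_series oo
       (- Abs_fps (\<lambda>i. if i = 0 then 0 else (- 1) ^ i * (\<lambda>g. adams G i f g / of_nat i)))"

definition lambda_op :: "('a, 'm) monoid_scheme \<Rightarrow> nat \<Rightarrow> ('a \<Rightarrow> complex) \<Rightarrow> 'a \<Rightarrow> complex" where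
  "lambda_op G i f = fps_nth (lambda_t G f) i"

definition lambda_t_at ::
  "('a, 'm) monoid_scheme \<Rightarrow> ('a \<Rightarrow> complex) \<Rightarrow> 'a \<Rightarrow> complex fps" where
  "lambda_t_at G f g = Abs_fps (\<lambda>i. lambda_op G i f g)"

text \<open>Multivariate polynomials: finitely supported functions from monomials (exponent vectors)
  to coefficients.\<close>

definition eval_poly :: "('v \<Rightarrow> complex) \<Rightarrow> (('v \<Rightarrow>\<^sub>0 nat) \<Rightarrow>\<^sub>0 complex) \<Rightarrow> complex" where
  "eval_poly x P =
     (\<Sum>m \<in> Poly_Mapping.keys P. Poly_Mapping.lookup P m *
        (\<Prod>v \<in> Poly_Mapping.keys m. x v ^ Poly_Mapping.lookup m v))"

text \<open>The value at the coefficients of two power series: the variable \<open>Inl i\<close> stands for the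
  coefficient of \<open>t ^ i\<close> in the first series, and \<open>Inr i\<close> for that in the second one.\<close>

definition eval_coeffs ::
  "complex fps \<Rightarrow> complex fps \<Rightarrow> ((nat + nat \<Rightarrow>\<^sub>0 nat) \<Rightarrow>\<^sub>0 complex) \<Rightarrow> complex" where
  "eval_coeffs f h = eval_poly (case_sum (fps_nth f) (fps_nth h))"

text \<open>The \<open>n\<close>-th universal polynomial is determined by
  \<open>\<Prod>(1 + a\<^sub>i t) \<cdot> \<Prod>(1 + b\<^sub>j t) = \<Prod>(1 + a\<^sub>i b\<^sub>j t)\<close> for all finite families \<open>a\<close> and \<open>b\<close>, as a
  function on pairs of series with constant term 1: over the complex numbers, every such series
  agrees up to any given order with a product of factors \<open>1 + a t\<close>. It is determined as a
  polynomial only up to the variables \<open>Inl 0\<close> and \<open>Inr 0\<close>, which always take the value 1;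
  hence \<open>SOME\<close> instead of \<open>THE\<close>.\<close>

definition Lambda_poly :: "nat \<Rightarrow> (nat + nat \<Rightarrow>\<^sub>0 nat) \<Rightarrow>\<^sub>0 complex" where
  "Lambda_poly n = (SOME P.
     \<forall>(k::nat) (l::nat) (a :: nat \<Rightarrow> complex) (b :: nat \<Rightarrow> complex).
       eval_coeffs (\<Prod>i<k. 1 + fps_const (a i) * fps_X) (\<Prod>j<l. 1 + fps_const (b j) * fps_X) P =
       fps_nth (\<Prod>i<k. \<Prod>j<l. 1 + fps_const (a i * b j) * fps_X) n)"

definition Lambda :: "complex fps ring" where
  "Lambda = \<lparr>
     carrier = {f. fps_nth f 0 = 1},
     mult = (\<lambda>f h. Abs_fps (\<lambda>n. eval_coeffs f h (Lambda_poly n))),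
     one = 1 + fps_X,
     zero = 1,
     add = (*)\<rparr>"

end

theory Submission
  imports Defs
    "HOL-Computational_Algebra.Fundamental_Theorem_Algebra"
    "HOL-Computational_Algebra.Polynomial_FPS"
begin

text \<open>Over the complex numbers, a power series with constant term 1 is determined by its power
  sums, the coefficients of its logarithmic derivative up to sign. For a value of \<open>\<lambda>\<^sub>t\<close> these
  are the Adams operations, which are multiplicative, and for \<open>\<Prod>(1 + a\<^sub>i t)\<close> they are
  \<open>\<Sum>a\<^sub>i ^ n\<close>. Newton's identities make the coefficients of the series with power sums
  \<open>p\<^sub>n q\<^sub>n\<close> polynomials in the coefficients of the two given series, which shows that the universal
  polynomials exist. By the fundamental theorem of algebra any two series agree up to any given
  order with finite products \<open>\<Prod>(1 + a\<^sub>i t)\<close>, so every choice of universal polynomials multiplies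
  power sums.\<close>

section \<open>Polynomial functions\<close>

definition eval_monom :: "('v \<Rightarrow> complex) \<Rightarrow> ('v \<Rightarrow>\<^sub>0 nat) \<Rightarrow> complex" where
  "eval_monom x m = (\<Prod>v \<in> Poly_Mapping.keys m. x v ^ Poly_Mapping.lookup m v)"

lemma eval_monom_superset:
  assumes "finite S" "Poly_Mapping.keys m \<subseteq> S"
  shows "eval_monom x m = (\<Prod>v\<in>S. x v ^ Poly_Mapping.lookup m v)"
  unfolding eval_monom_def using assms
  by (intro prod.mono_neutral_left) (auto simp: in_keys_iff)

lemma eval_monom_add: "eval_monom x (m + m') = eval_monom x m * eval_monom x m'"
proof -
  let ?S = "Poly_Mapping.keys m \<union> Poly_Mapping.keys m'"
  have "finite ?S" "Poly_Mapping.keys (m + m') \<subseteq> ?S"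
    by (auto dest: set_mp[OF keys_add])
  then show ?thesis
    by (simp add: eval_monom_superset[of ?S] lookup_add power_add prod.distrib)
qed

lemma eval_poly_superset:
  assumes "finite S" "Poly_Mapping.keys P \<subseteq> S"
  shows "eval_poly x P = (\<Sum>m\<in>S. Poly_Mapping.lookup P m * eval_monom x m)"
  unfolding eval_poly_def eval_monom_def[symmetric] using assms
  by (intro sum.mono_neutral_left) (auto simp: in_keys_iff)

lemma eval_poly_zero [simp]: "eval_poly x 0 = 0"
  by (simp add: eval_poly_def)

lemma eval_poly_add: "eval_poly x (P + Q) = eval_poly x P + eval_poly x Q"
proof -
  let ?S = "Poly_Mapping.keys P \<union> Poly_Mapping.keys Q"
  have "finite ?S" "Poly_Mapping.keys (P + Q) \<subseteq> ?S"
    by (auto dest: set_mp[OF keys_add])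
  then show ?thesis
    by (simp add: eval_poly_superset[of ?S] lookup_add distrib_right sum.distrib)
qed

lemma eval_poly_single: "eval_poly x (Poly_Mapping.single m c) = c * eval_monom x m"
  by (simp add: eval_poly_superset[of "{m}"])

text \<open>Every polynomial is a finite sum of single terms, so a claim additive in
  \<open>P\<close> need only be checked on monomials.\<close>

lemma poly_mapping_single_induct [case_names zero add]:
  fixes P :: "'k \<Rightarrow>\<^sub>0 'c::comm_monoid_add"
  assumes "R 0" and "\<And>m c P. R P \<Longrightarrow> R (Poly_Mapping.single m c + P)"
  shows "R P"
proof (induction P rule: update_induct)
  case (update P m c)
  \<comment> \<open>The key \<open>m\<close> is fresh, so overwriting its entry 0 amounts to
    adding.\<close>
  have "Poly_Mapping.update m c P = Poly_Mapping.single m c + P"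
    using update(1) by (intro poly_mapping_eqI)
      (auto simp: lookup_update lookup_add lookup_single in_keys_iff when_def)
  then show ?case using assms(2) update by simp
qed (rule assms(1))

lemma eval_poly_mult: "eval_poly x (P * Q) = eval_poly x P * eval_poly x Q"
proof (induction P rule: poly_mapping_single_induct)
  case (add m c P)
  have "eval_poly x (Poly_Mapping.single m c * Q) = c * eval_monom x m * eval_poly x Q"
    by (induction Q rule: poly_mapping_single_induct)
      (simp_all add: distrib_left mult_single eval_poly_add eval_poly_single eval_monom_add)
  with add show ?case
    by (simp add: distrib_right eval_poly_add eval_poly_single)
qed simp

text \<open>One \<open>P\<close> has to serve all points \<open>x\<close>. Closure under ring
  operations then yields polynomials without writing them down.\<close>

definition polynomial_fun :: "(('v \<Rightarrow> complex) \<Rightarrow> complex) \<Rightarrow> bool" where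
  "polynomial_fun F \<longleftrightarrow> (\<exists>P. \<forall>x. eval_poly x P = F x)"

lemma polynomial_fun_const: "polynomial_fun (\<lambda>x. c)"
  unfolding polynomial_fun_def
  by (rule exI[of _ "Poly_Mapping.single 0 c"]) (simp add: eval_poly_single eval_monom_def)

lemma polynomial_fun_var: "polynomial_fun (\<lambda>x. x v)"
  unfolding polynomial_fun_def
  by (rule exI[of _ "Poly_Mapping.single (Poly_Mapping.single v 1) 1"])
    (simp add: eval_poly_single eval_monom_def)

lemma polynomial_fun_add:
  "polynomial_fun F \<Longrightarrow> polynomial_fun G \<Longrightarrow> polynomial_fun (\<lambda>x. F x + G x)"
  unfolding polynomial_fun_def by (metis eval_poly_add)

lemma polynomial_fun_mult:
  "polynomial_fun F \<Longrightarrow> polynomial_fun G \<Longrightarrow> polynomial_fun (\<lambda>x. F x * G x)"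
  unfolding polynomial_fun_def by (metis eval_poly_mult)

lemma polynomial_fun_diff:
  assumes "polynomial_fun F" "polynomial_fun G"
  shows "polynomial_fun (\<lambda>x. F x - G x)"
  using polynomial_fun_add[OF assms(1) polynomial_fun_mult[OF polynomial_fun_const[of "-1"] assms(2)]]
  by simp

lemma polynomial_fun_sum:
  "(\<And>i. i \<in> A \<Longrightarrow> polynomial_fun (F i)) \<Longrightarrow> polynomial_fun (\<lambda>x. \<Sum>i\<in>A. F i x)"
  by (induction A rule: infinite_finite_induct)
    (auto intro: polynomial_fun_const polynomial_fun_add)

lemmas polynomial_fun_intros =
  polynomial_fun_const polynomial_fun_add polynomial_fun_mult polynomial_fun_diff
  polynomial_fun_sum

lemma eval_poly_cong:
  assumes "\<And>m v. m \<in> Poly_Mapping.keys P \<Longrightarrow> v \<in> Poly_Mapping.keys m \<Longrightarrow> x v = y v"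
  shows "eval_poly x P = eval_poly y P"
  unfolding eval_poly_def using assms by (intro sum.cong prod.cong arg_cong2[of _ _ _ _ "(*)"]) auto

text \<open>Only finitely many variables occur in \<open>P\<close>, and \<open>N\<close> bounds
  their indices.\<close>

lemma eval_coeffs_depends_on_initial_coeffs:
  obtains N where "\<And>f f' h h'. (\<And>i. i \<le> N \<Longrightarrow> fps_nth f i = fps_nth f' i) \<Longrightarrow>
    (\<And>i. i \<le> N \<Longrightarrow> fps_nth h i = fps_nth h' i) \<Longrightarrow> eval_coeffs f h P = eval_coeffs f' h' P"
proof -
  \<comment> \<open>\<open>case_sum id id\<close> forgets which of the two series a variable belongs
    to and keeps its index.\<close>
  let ?V = "case_sum id id ` (\<Union>m\<in>Poly_Mapping.keys P. Poly_Mapping.keys m)"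
  have "finite ?V" by auto
  then obtain N where "\<forall>i\<in>?V. i \<le> N" using finite_nat_set_iff_bounded_le by blast
  then have N: "case_sum id id v \<le> N"
    if "m \<in> Poly_Mapping.keys P" "v \<in> Poly_Mapping.keys m" for m v
    using that by blast
  show ?thesis
  proof
    fix f f' h h' :: "complex fps"
    assume eq: "\<And>i. i \<le> N \<Longrightarrow> fps_nth f i = fps_nth f' i" "\<And>i. i \<le> N \<Longrightarrow> fps_nth h i = fps_nth h' i"
    show "eval_coeffs f h P = eval_coeffs f' h' P"
      unfolding eval_coeffs_def
    proof (rule eval_poly_cong)
      fix m v assume "m \<in> Poly_Mapping.keys P" "v \<in> Poly_Mapping.keys m"
      then show "case_sum (fps_nth f) (fps_nth h) v = case_sum (fps_nth f') (fps_nth h') v"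
        using N[of m v] eq by (cases v) auto
    qed
  qed
qed

section \<open>Power sums of a power series\<close>

text \<open>The index is shifted: \<open>p i\<close> is the power sum of degree \<open>i + 1\<close>.\<close>

definition has_power_sums :: "complex fps \<Rightarrow> (nat \<Rightarrow> complex) \<Rightarrow> bool" where
  "has_power_sums f p \<longleftrightarrow>
     fps_nth f 0 = 1 \<and> fps_deriv f = f * Abs_fps (\<lambda>i. (- 1) ^ i * p i)"

lemma has_power_sums_one: "has_power_sums 1 (\<lambda>i. 0)"
  by (simp add: has_power_sums_def fps_eq_iff fps_mult_nth)

text \<open>The logarithmic derivative f'/f turns products into sums.\<close>

lemma has_power_sums_mult:
  assumes "has_power_sums f p" "has_power_sums h q"
  shows "has_power_sums (f * h) (\<lambda>i. p i + q i)"
proof -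
  have "Abs_fps (\<lambda>i. (- 1) ^ i * (p i + q i)) =
      Abs_fps (\<lambda>i. (- 1) ^ i * p i) + Abs_fps (\<lambda>i. (- 1) ^ i * q i)"
    by (simp add: fps_eq_iff distrib_left)
  with assms show ?thesis
    by (simp add: has_power_sums_def algebra_simps)
qed

lemma has_power_sums_prod:
  assumes "\<And>j. j \<in> A \<Longrightarrow> has_power_sums (f j) (p j)"
  shows "has_power_sums (\<Prod>j\<in>A. f j) (\<lambda>i. \<Sum>j\<in>A. p j i)"
  using assms
  by (induction A rule: infinite_finite_induct)
    (auto intro: has_power_sums_one has_power_sums_mult)

text \<open>The geometric series of a / (1 + a t), the logarithmic derivative of 1 + a t.\<close>

lemma has_power_sums_linear: "has_power_sums (1 + fps_const a * fps_X) (\<lambda>i. a ^ Suc i)"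
proof -
  have "fps_nth ((1 + fps_const a * fps_X) * Abs_fps (\<lambda>i. (- 1) ^ i * a ^ Suc i)) n =
      fps_nth (fps_const a) n" for n
    by (cases n) (simp_all add: distrib_right mult.assoc)
  then show ?thesis
    by (simp add: has_power_sums_def fps_eq_iff)
qed

text \<open>Newton's identity solved for the power sum: its summand i = n carries the factor
  \<open>e 0\<close>, taken to be 1, and the sign (-1)^n is its own inverse.\<close>

fun power_sum :: "(nat \<Rightarrow> complex) \<Rightarrow> nat \<Rightarrow> complex" where
  "power_sum e n = (- 1) ^ n *
     (of_nat (Suc n) * e (Suc n) - (\<Sum>i<n. (- 1) ^ i * power_sum e i * e (n - i)))"

text \<open>Newton's identity solved for the coefficient of degree n + 1.\<close>

fun from_power_sums :: "(nat \<Rightarrow> complex) \<Rightarrow> nat \<Rightarrow> complex" where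
  "from_power_sums p 0 = 1"
| "from_power_sums p (Suc n) =
     1 / of_nat (Suc n) * (\<Sum>i<Suc n. (- 1) ^ i * p i * from_power_sums p (n - i))"

declare power_sum.simps [simp del] from_power_sums.simps(2) [simp del]

text \<open>Compare the coefficients of t^n in the differential equation of
  \<open>has_power_sums\<close>.\<close>

lemma newton_identity:
  assumes "has_power_sums f p"
  shows "of_nat (Suc n) * fps_nth f (Suc n) = (\<Sum>i<Suc n. (- 1) ^ i * p i * fps_nth f (n - i))"
proof -
  have "of_nat (Suc n) * fps_nth f (Suc n) = fps_nth (fps_deriv f) n"
    by simp
  also have "\<dots> = fps_nth (Abs_fps (\<lambda>i. (- 1) ^ i * p i) * f) n"
    using assms by (simp add: has_power_sums_def mult.commute)
  also have "\<dots> = (\<Sum>i<Suc n. (- 1) ^ i * p i * fps_nth f (n - i))"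
    by (simp add: fps_mult_nth atLeast0AtMost lessThan_Suc_atMost)
  finally show ?thesis .
qed

lemma power_sum_eq:
  assumes "has_power_sums f p"
  shows "power_sum (fps_nth f) n = p n"
proof (induction n rule: less_induct)
  case (less n)
  have "fps_nth f 0 = 1" using assms by (simp add: has_power_sums_def)
  then have "of_nat (Suc n) * fps_nth f (Suc n) -
      (\<Sum>i<n. (- 1) ^ i * p i * fps_nth f (n - i)) = (- 1) ^ n * p n"
    unfolding newton_identity[OF assms] by simp
  moreover have "(\<Sum>i<n. (- 1) ^ i * power_sum (fps_nth f) i * fps_nth f (n - i)) =
      (\<Sum>i<n. (- 1) ^ i * p i * fps_nth f (n - i))"
    using less by (intro sum.cong) auto
  ultimately show ?case
    by (subst power_sum.simps) (simp add: mult.assoc[symmetric] flip: power_mult_distrib)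
qed

text \<open>The coefficients of \<open>f\<close> obey the same recursion; hence a series is
  determined by its power sums.\<close>

lemma from_power_sums_eq:
  assumes "has_power_sums f p"
  shows "from_power_sums p n = fps_nth f n"
proof (induction n rule: less_induct)
  case (less n)
  show ?case
  proof (cases n)
    case 0
    then show ?thesis using assms by (simp add: has_power_sums_def)
  next
    case (Suc m)
    have "(\<Sum>i<Suc m. (- 1) ^ i * p i * from_power_sums p (m - i)) =
        (\<Sum>i<Suc m. (- 1) ^ i * p i * fps_nth f (m - i))"
      using less Suc by (intro sum.cong) auto
    also have "\<dots> = of_nat (Suc m) * fps_nth f (Suc m)"
      by (rule newton_identity[OF assms, symmetric])
    finally show ?thesis
      unfolding Suc from_power_sums.simps(2) by (simp del: of_nat_Suc sum.lessThan_Suc)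
  qed
qed

lemma polynomial_fun_power_sum:
  assumes "\<And>i. polynomial_fun (\<lambda>x. e x i)"
  shows "polynomial_fun (\<lambda>x. power_sum (e x) n)"
proof (induction n rule: less_induct)
  case (less n)
  then show ?case
    by (subst power_sum.simps) (intro polynomial_fun_intros assms; simp)
qed

text \<open>Dividing by \<open>of_nat (Suc n)\<close> is multiplying by a constant, so the recursion
  stays polynomial.\<close>

lemma polynomial_fun_from_power_sums:
  assumes "\<And>i. polynomial_fun (\<lambda>x. p x i)"
  shows "polynomial_fun (\<lambda>x. from_power_sums (p x) n)"
proof (induction n rule: less_induct)
  case (less n)
  show ?case
  proof (cases n)
    case 0
    then show ?thesis by (simp add: polynomial_fun_const)
  next
    case (Suc m)
    have "polynomial_fun (\<lambda>x. from_power_sums (p x) (m - i))" for i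
      using less Suc by simp
    then show ?thesis
      unfolding Suc from_power_sums.simps(2) by (intro polynomial_fun_intros assms)
  qed
qed

section \<open>The universal polynomials\<close>

text \<open>Truncate \<open>f\<close> after degree \<open>N\<close>, split the resulting polynomial
  over its roots, and normalise each factor to constant term 1.\<close>

lemma initial_coeffs_linear_factors:
  fixes f :: "complex fps"
  assumes "fps_nth f 0 = 1"
  obtains k :: nat and a where
    "\<And>i. i \<le> N \<Longrightarrow> fps_nth (\<Prod>j<k. 1 + fps_const (a j) * fps_X) i = fps_nth f i"
proof -
  define p where "p = Poly (map (fps_nth f) [0..<Suc N])"
  have coeff: "coeff p i = fps_nth f i" if "i \<le> N" for i
    using that by (auto simp: p_def nth_default_def simp del: upt_Suc)
  obtain r where r: "smult (lead_coeff p) (\<Prod>i<degree p. [:- r i, 1:]) = p"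
    by (rule complex_poly_decompose')
  have "poly p 0 = 1"
    using coeff[of 0] assms by (simp add: poly_0_coeff_0)
  \<comment> \<open>Evaluation of the factorisation at 0. It excludes the root 0 and later cancels
    the normalising constants.\<close>
  then have const: "lead_coeff p * (\<Prod>i<degree p. - r i) = 1"
    by (subst (asm) r[symmetric]) (simp add: poly_prod)
  then have nz: "r i \<noteq> 0" if "i < degree p" for i
    using that by (metis finite_lessThan lessThan_iff mult_zero_right neg_equal_0_iff_equal prod_zero_iff zero_neq_one)
  have factor: "fps_of_poly [:- r i, 1:] = fps_const (- r i) * (1 + fps_const (- 1 / r i) * fps_X)"
    if "i < degree p" for i
    using nz[OF that]
    by (auto simp: fps_eq_iff fps_of_poly_def coeff_pCons distrib_left fps_X_def split: nat.split)
  have const_prod: "fps_const (\<Prod>i<m. - r i) = (\<Prod>i<m. fps_const (- r i))" for m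
    by (induction m) (simp_all only: prod.lessThan_Suc fps_const_mult[symmetric] lessThan_0 prod.empty fps_const_1_eq_1)
  have "fps_of_poly p =
      fps_const (lead_coeff p) * (\<Prod>i<degree p. fps_of_poly [:- r i, 1:])"
    by (subst r[symmetric]) (simp only: fps_of_poly_smult fps_of_poly_prod)
  also have "(\<Prod>i<degree p. fps_of_poly [:- r i, 1:]) =
      fps_const (\<Prod>i<degree p. - r i) * (\<Prod>i<degree p. 1 + fps_const (- 1 / r i) * fps_X)"
    unfolding const_prod prod.distrib[symmetric] using factor by (intro prod.cong) auto
  also have "fps_const (lead_coeff p) * \<dots> =
      (\<Prod>i<degree p. 1 + fps_const (- 1 / r i) * fps_X)"
    by (simp only: mult.assoc[symmetric] fps_const_mult const) simp
  finally show ?thesis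
    using coeff that[of "\<lambda>i. - 1 / r i" "degree p"] by (metis fps_of_poly_nth)
qed

lemma has_power_sums_linear_factors:
  "has_power_sums (\<Prod>i<k::nat. 1 + fps_const (a i) * fps_X) (\<lambda>n. \<Sum>i<k. a i ^ Suc n)"
  by (intro has_power_sums_prod has_power_sums_linear)

text \<open>The property under \<open>SOME\<close> in \<open>Lambda_poly\<close>.\<close>

definition is_Lambda_poly :: "nat \<Rightarrow> ((nat + nat \<Rightarrow>\<^sub>0 nat) \<Rightarrow>\<^sub>0 complex) \<Rightarrow> bool" where
  "is_Lambda_poly n P \<longleftrightarrow>
     (\<forall>(k::nat) (l::nat) (a :: nat \<Rightarrow> complex) (b :: nat \<Rightarrow> complex).
       eval_coeffs (\<Prod>i<k. 1 + fps_const (a i) * fps_X) (\<Prod>j<l. 1 + fps_const (b j) * fps_X) P =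
       fps_nth (\<Prod>i<k. \<Prod>j<l. 1 + fps_const (a i * b j) * fps_X) n)"

text \<open>\<open>Q\<close> passes from coefficients to power sums, multiplies these, and passes
  back. The second conclusion covers arbitrary series, not only finite products.\<close>

lemma newton_Lambda_poly:
  obtains Q where "is_Lambda_poly n Q"
    and "\<And>f h r p q. has_power_sums f p \<Longrightarrow> has_power_sums h q \<Longrightarrow>
      has_power_sums r (\<lambda>i. p i * q i) \<Longrightarrow> eval_coeffs f h Q = fps_nth r n"
proof -
  have "polynomial_fun (\<lambda>x :: nat + nat \<Rightarrow> complex. from_power_sums
      (\<lambda>i. power_sum (\<lambda>j. x (Inl j)) i * power_sum (\<lambda>j. x (Inr j)) i) n)"
    by (intro polynomial_fun_from_power_sums polynomial_fun_mult polynomial_fun_power_sum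
        polynomial_fun_var)
  then obtain Q where Q: "\<And>x. eval_poly x Q = from_power_sums
      (\<lambda>i. power_sum (\<lambda>j. x (Inl j)) i * power_sum (\<lambda>j. x (Inr j)) i) n"
    unfolding polynomial_fun_def by auto
  have main: "eval_coeffs f h Q = fps_nth r n"
    if "has_power_sums f p" "has_power_sums h q" "has_power_sums r (\<lambda>i. p i * q i)" for f h r p q
    using that(1,2) from_power_sums_eq[OF that(3)]
    by (simp add: eval_coeffs_def Q power_sum_eq)
  moreover have "is_Lambda_poly n Q"
    unfolding is_Lambda_poly_def
  proof (intro allI)
    fix k l :: nat and a b :: "nat \<Rightarrow> complex"
    have "has_power_sums (\<Prod>i<k. \<Prod>j<l. 1 + fps_const (a i * b j) * fps_X)
        (\<lambda>n. \<Sum>i<k. \<Sum>j<l. (a i * b j) ^ Suc n)"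
      by (intro has_power_sums_prod has_power_sums_linear)
    \<comment> \<open>The double sum of the powers of \<open>a i * b j\<close> factors into the
      product of the two power sums.\<close>
    then show "eval_coeffs (\<Prod>i<k. 1 + fps_const (a i) * fps_X)
        (\<Prod>j<l. 1 + fps_const (b j) * fps_X) Q =
      fps_nth (\<Prod>i<k. \<Prod>j<l. 1 + fps_const (a i * b j) * fps_X) n"
      by (intro main[OF has_power_sums_linear_factors has_power_sums_linear_factors])
        (simp only: sum_product power_mult_distrib)
  qed
  ultimately show ?thesis using that by blast
qed

text \<open>\<open>P\<close> and \<open>Q\<close> agree on products of linear factors and see only
  finitely many coefficients, up to which \<open>f\<close> and \<open>h\<close> are such
  products.\<close>

lemma is_Lambda_poly_unique:
  assumes "is_Lambda_poly n P" "is_Lambda_poly n Q" "fps_nth f 0 = 1" "fps_nth h 0 = 1"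
  shows "eval_coeffs f h P = eval_coeffs f h Q"
proof -
  obtain M where M: "\<And>f f' h h'. (\<And>i. i \<le> M \<Longrightarrow> fps_nth f i = fps_nth f' i) \<Longrightarrow>
    (\<And>i. i \<le> M \<Longrightarrow> fps_nth h i = fps_nth h' i) \<Longrightarrow> eval_coeffs f h P = eval_coeffs f' h' P"
    using eval_coeffs_depends_on_initial_coeffs[of P] by blast
  obtain N where N: "\<And>f f' h h'. (\<And>i. i \<le> N \<Longrightarrow> fps_nth f i = fps_nth f' i) \<Longrightarrow>
    (\<And>i. i \<le> N \<Longrightarrow> fps_nth h i = fps_nth h' i) \<Longrightarrow> eval_coeffs f h Q = eval_coeffs f' h' Q"
    using eval_coeffs_depends_on_initial_coeffs[of Q] by blast
  obtain k :: nat and a where a: "\<And>i. i \<le> max M N \<Longrightarrow>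
      fps_nth (\<Prod>j<k. 1 + fps_const (a j) * fps_X) i = fps_nth f i"
    using initial_coeffs_linear_factors[OF assms(3), of "max M N"] by blast
  obtain l :: nat and b where b: "\<And>i. i \<le> max M N \<Longrightarrow>
      fps_nth (\<Prod>j<l. 1 + fps_const (b j) * fps_X) i = fps_nth h i"
    using initial_coeffs_linear_factors[OF assms(4), of "max M N"] by blast
  let ?f = "\<Prod>j<k. 1 + fps_const (a j) * fps_X" and ?h = "\<Prod>j<l. 1 + fps_const (b j) * fps_X"
  have "eval_coeffs f h P = eval_coeffs ?f ?h P"
    by (rule M) (simp_all add: a b)
  also have "\<dots> = eval_coeffs ?f ?h Q"
    using assms(1,2) by (simp add: is_Lambda_poly_def)
  also have "\<dots> = eval_coeffs f h Q"
    by (rule N) (simp_all add: a b)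
  finally show ?thesis .
qed

text \<open>The values of the polynomial chosen by \<open>SOME\<close> are those of the Newton
  polynomial \<open>Q\<close>, for which the claim is known.\<close>

lemma Lambda_mult_power_sums:
  assumes "has_power_sums f p" "has_power_sums h q" "has_power_sums r (\<lambda>i. p i * q i)"
  shows "f \<otimes>\<^bsub>Lambda\<^esub> h = r"
proof -
  have "eval_coeffs f h (Lambda_poly n) = fps_nth r n" for n
  proof -
    obtain Q where Q: "is_Lambda_poly n Q" "eval_coeffs f h Q = fps_nth r n"
      using newton_Lambda_poly[of n] assms by metis
    have "is_Lambda_poly n (Lambda_poly n)"
      unfolding Lambda_poly_def is_Lambda_poly_def[symmetric] using Q(1) by (rule someI)
    then show ?thesis
      using is_Lambda_poly_unique[OF _ Q(1)] Q(2) assms(1,2) by (auto simp: has_power_sums_def)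
  qed
  then show ?thesis by (simp add: Lambda_def fps_eq_iff)
qed

section \<open>Values of the total lambda operation\<close>

definition fps_at :: "('a \<Rightarrow> complex) fps \<Rightarrow> 'a \<Rightarrow> complex fps" where
  "fps_at F g = Abs_fps (\<lambda>n. fps_nth F n g)"

lemma sum_fun_apply: "(\<Sum>i\<in>A. F i) g = (\<Sum>i\<in>A. F i g :: complex)"
  by (induction A rule: infinite_finite_induct) auto

lemma fps_at_mult: "fps_at (F * H) g = fps_at F g * fps_at H g"
  by (simp add: fps_at_def fps_eq_iff fps_mult_nth sum_fun_apply)

lemma fps_at_power: "fps_at (F ^ n) g = fps_at F g ^ n"
  by (induction n) (simp_all add: fps_at_mult, simp add: fps_at_def fps_eq_iff)

text \<open>Each coefficient of a composition is a finite sum of products of coefficients, and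
  evaluation at \<open>g\<close> respects sums and products.\<close>

lemma fps_at_compose: "fps_at (F oo H) g = fps_at F g oo fps_at H g"
proof -
  have "fps_nth (F ^ n) i g = fps_nth (fps_at F g ^ n) i" for F :: "('a \<Rightarrow> complex) fps" and n i
    unfolding fps_at_power[symmetric] by (simp add: fps_at_def)
  then show ?thesis
    by (subst fps_at_def) (simp add: fps_eq_iff fps_compose_nth sum_fun_apply, simp add: fps_at_def)
qed

text \<open>The sign in \<open>lambda_t\<close> is a power taken in the ring of functions.\<close>

lemma minus_one_power_fun_apply: "((- 1) ^ n :: 'a \<Rightarrow> complex) g = (- 1) ^ n"
  by (induction n) simp_all

text \<open>For L without constant term, (exp L)' = (exp L) L', so L' is the logarithmic
  derivative.\<close>

lemma has_power_sums_lambda_t_at: "has_power_sums (lambda_t_at G \<chi> g) (\<lambda>i. \<chi> (g [^]\<^bsub>G\<^esub> Suc i))"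
proof -
  define L where "L = - Abs_fps (\<lambda>i. if i = 0 then 0 else (- 1) ^ i * (\<chi> (g [^]\<^bsub>G\<^esub> i) / of_nat i))"
  have exp: "fps_at exp_series g = fps_exp 1"
    by (simp add: fps_at_def exp_series_def fps_exp_def)
  have "lambda_t_at G \<chi> g = fps_at (lambda_t G \<chi>) g"
    by (simp add: lambda_t_at_def lambda_op_def fps_at_def)
  also have "\<dots> = fps_exp 1 oo L"
    unfolding lambda_t_def fps_at_compose exp
    by (rule arg_cong[of _ _ "fps_compose _"])
      (auto simp: fps_at_def fps_eq_iff L_def adams_def minus_one_power_fun_apply)
  finally have eq: "lambda_t_at G \<chi> g = fps_exp 1 oo L" .
  \<comment> \<open>Differentiation cancels the denominator and shifts the index; the outer minus
    sign absorbs the resulting change of sign.\<close>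
  have "fps_deriv L = Abs_fps (\<lambda>i. (- 1) ^ i * \<chi> (g [^]\<^bsub>G\<^esub> Suc i))"
    by (auto simp: fps_eq_iff L_def simp del: of_nat_Suc)
  moreover have "fps_nth L 0 = 0"
    by (simp add: L_def)
  ultimately show ?thesis
    by (simp add: has_power_sums_def eq fps_compose_deriv)
qed

lemma nat_pow_DirProd:
  "(g\<^sub>1, g\<^sub>2) [^]\<^bsub>G\<^sub>1 \<times>\<times> G\<^sub>2\<^esub> (n :: nat) = (g\<^sub>1 [^]\<^bsub>G\<^sub>1\<^esub> n, g\<^sub>2 [^]\<^bsub>G\<^sub>2\<^esub> n)"
  by (induction n) (simp_all add: nat_pow_def)

theorem theorem3p34:
  fixes G\<^sub>1 :: "('a, 'm) monoid_scheme" and G\<^sub>2 :: "('b, 'n) monoid_scheme"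
    and \<chi>\<^sub>1 :: "'a \<Rightarrow> complex" and \<chi>\<^sub>2 :: "'b \<Rightarrow> complex"
  assumes "group G\<^sub>1" and "finite (carrier G\<^sub>1)"
    and "group G\<^sub>2" and "finite (carrier G\<^sub>2)"
    and "virtual_character G\<^sub>1 \<chi>\<^sub>1" and "virtual_character G\<^sub>2 \<chi>\<^sub>2"
  shows "\<forall>g\<^sub>1 \<in> carrier G\<^sub>1. \<forall>g\<^sub>2 \<in> carrier G\<^sub>2.
    lambda_t_at (G\<^sub>1 \<times>\<times> G\<^sub>2) (ext_prod \<chi>\<^sub>1 \<chi>\<^sub>2) (g\<^sub>1, g\<^sub>2) =
      lambda_t_at G\<^sub>1 \<chi>\<^sub>1 g\<^sub>1 \<otimes>\<^bsub>Lambda\<^esub> lambda_t_at G\<^sub>2 \<chi>\<^sub>2 g\<^sub>2"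
proof (intro ballI)
  fix g\<^sub>1 g\<^sub>2
  \<comment> \<open>Powers in the direct product are componentwise, so the power sums of the
    left-hand side are products.\<close>
  have "has_power_sums (lambda_t_at (G\<^sub>1 \<times>\<times> G\<^sub>2) (ext_prod \<chi>\<^sub>1 \<chi>\<^sub>2) (g\<^sub>1, g\<^sub>2))
      (\<lambda>i. \<chi>\<^sub>1 (g\<^sub>1 [^]\<^bsub>G\<^sub>1\<^esub> Suc i) * \<chi>\<^sub>2 (g\<^sub>2 [^]\<^bsub>G\<^sub>2\<^esub> Suc i))"
    using has_power_sums_lambda_t_at[of "G\<^sub>1 \<times>\<times> G\<^sub>2" "ext_prod \<chi>\<^sub>1 \<chi>\<^sub>2" "(g\<^sub>1, g\<^sub>2)"]
    by (simp only: nat_pow_DirProd ext_prod_def case_prod_conv)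
  then show "lambda_t_at (G\<^sub>1 \<times>\<times> G\<^sub>2) (ext_prod \<chi>\<^sub>1 \<chi>\<^sub>2) (g\<^sub>1, g\<^sub>2) =
      lambda_t_at G\<^sub>1 \<chi>\<^sub>1 g\<^sub>1 \<otimes>\<^bsub>Lambda\<^esub> lambda_t_at G\<^sub>2 \<chi>\<^sub>2 g\<^sub>2"
    by (rule Lambda_mult_power_sums[OF has_power_sums_lambda_t_at has_power_sums_lambda_t_at, symmetric])
qed

end
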